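(* Let $\Bbbk$ be a field of characteristic different from $2$, let $V$ be a finite-dimensional $\Bbbk$-vector space with ordered basis $(x_1,\dots,x_n)$, and let $A=\bigwedge^*V$ be its exterior algebra, viewed as a Frobenius algebra with respect to the bilinear form $\langle a,b\rangle=\int(a\wedge b)$, with Nakayama automorphism $\sigma$. (i) If $a$ is an element of $A^{\mathsf{od}}$, then $\mathrm{div}_\sigma(\mathrm{ad}(a))=-2a$ if $n$ is even, and $\mathrm{div}_\sigma(\mathrm{ad}(a))=0$ if $n$ is odd. (ii) If $a_1,\dots,a_n$ are elements of $A^{\mathsf{od}}$, then $$\mathrm{div}_\sigma(a_1\partial_1+\cdots+a_n\partial_n)=\partial_1(a_1)+\cdots+\partial_n(a_n).$$
   Context: $\int:A\to\Bbbk$ is the linear form vanishing on $\bigwedge^iV$ for $0\le i\le n-1$ with $\int(x_1\wedge\cdots\wedge x_n)=1$. The form $\langle a,b\rangle=\int(a\wedge b)$ is non-degenerate and associative, and its Nakayama automorphism $\sigma$ is the unique algebra automorphism with $\langle a,b\rangle=\langle b,\sigma(a)\rangle$ for all $a,b$; explicitly $\sigma(x)=(-1)^{n-1}x$ for $x\in V$. The Nakayama divergence of a derivation $\delta:A\to A$ is the unique element $\mathrm{div}_\sigma(\delta)\in A$ such that $\langle\delta(a),b\rangle+\langle a,\delta(b)\rangle=\langle a,b\cdot\mathrm{div}_\sigma(\delta)\rangle$ for all $a,b\in A$. $A^{\mathsf{od}}$ is the span of the homogeneous elements of odd degree; $\mathrm{ad}(a)$ is the inner derivation $b\mapsto ab-ba$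 (with product $\wedge$). A left skew derivation of $A$ is a linear map $\partial$ with $\partial(ab)=\partial(a)b+(-1)^ia\,\partial(b)$ whenever $a\in\bigwedge^iV$, $b\in A$; $\partial_j$ is the unique left skew derivation with $\partial_j(x_i)=\delta_{i,j}$ for all $i$. For $a_1,\dots,a_n\in A^{\mathsf{od}}$, the map $b\mapsto\sum_ia_i\wedge\partial_i(b)$, denoted $\sum_ia_i\partial_i$, is a derivation of $A$. *)

theory Defs
  imports Complex_Main "HOL-Library.Poly_Mapping"
begin

text \<open>
  Words over an alphabet form the free monoid (written additively, as required by the
  convolution product of \<^typ>\<open>'w \<Rightarrow>\<^sub>0 'k\<close>), so \<open>'v word \<Rightarrow>\<^sub>0 'k\<close> is the free associative
  unital \<open>'k\<close>-algebra on the set \<open>'v\<close>. A separate type is used in order not to put a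
  \<open>monoid_add\<close> instance on lists.
\<close>

datatype 'v word = Word (letters: "'v list")

instantiation word :: (type) monoid_add
begin

definition zero_word :: "'v word" where
  "zero_word = Word []"

definition plus_word :: "'v word \<Rightarrow> 'v word \<Rightarrow> 'v word" where
  "plus_word u w = Word (letters u @ letters w)"

instance
  by standard (simp_all add: zero_word_def plus_word_def)

end

definition gen :: "'v \<Rightarrow> ('v word \<Rightarrow>\<^sub>0 'k::field)" where
  "gen v = Poly_Mapping.single (Word [v]) 1"

definition const :: "'k::field \<Rightarrow> ('v word \<Rightarrow>\<^sub>0 'k)" where
  "const c = Poly_Mapping.single 0 c"

inductive_set two_sided_ideal :: "'r::ring_1 set \<Rightarrow> 'r set" for S where
  base: "s \<in> S \<Longrightarrow> s \<in> two_sided_ideal S"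
| zero: "0 \<in> two_sided_ideal S"
| add: "p \<in> two_sided_ideal S \<Longrightarrow> q \<in> two_sided_ideal S \<Longrightarrow> p + q \<in> two_sided_ideal S"
| mult: "p \<in> two_sided_ideal S \<Longrightarrow> r * p * s \<in> two_sided_ideal S"

text \<open>
  Dividing the free algebra on the set \<open>V\<close> by the tensor relations gives the tensor algebra
  \<open>T(V)\<close>; the exterior algebra is the quotient of \<open>T(V)\<close> by the squares \<open>v \<otimes> v\<close>.
\<close>

definition tensor_relations ::
    "('k::field \<Rightarrow> 'v::ab_group_add \<Rightarrow> 'v) \<Rightarrow> ('v word \<Rightarrow>\<^sub>0 'k) set" where
  "tensor_relations scaleV =
     {gen (u + v) - gen u - gen v | u v. True} \<union>
     {gen (scaleV c v) - const c * gen v | c v. True}"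

definition square_relations :: "('v word \<Rightarrow>\<^sub>0 'k::field) set" where
  "square_relations = {gen v * gen v | v. True}"

definition free_eval ::
    "('k::field \<Rightarrow> 'a::ring_1 \<Rightarrow> 'a) \<Rightarrow> ('v \<Rightarrow> 'a) \<Rightarrow> ('v word \<Rightarrow>\<^sub>0 'k) \<Rightarrow> 'a" where
  "free_eval scaleA \<iota> p =
     (\<Sum>w\<in>Poly_Mapping.keys p.
        scaleA (Poly_Mapping.lookup p w) (prod_list (map \<iota> (letters w))))"

text \<open>
  The algebra \<open>A\<close> (the whole type \<open>'a\<close>) together with \<open>\<iota> : V \<rightarrow> A\<close> is an exterior algebra of
  \<open>V\<close> (the whole type \<open>'v\<close>): the homomorphism induced by \<open>\<iota>\<close> identifies \<open>A\<close> with
  \<open>T(V) / (v \<otimes> v)\<close>. The wedge product is the ring multiplication of \<open>'a\<close>; linearity of \<open>\<iota>\<close>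
  is a consequence of \<open>kernel\<close>.
\<close>

locale exterior_algebra =
  V: vector_space scaleV + A: vector_space scaleA
  for scaleV :: "'k::field \<Rightarrow> 'v::ab_group_add \<Rightarrow> 'v"
    and scaleA :: "'k \<Rightarrow> 'a::ring_1 \<Rightarrow> 'a" +
  fixes \<iota> :: "'v \<Rightarrow> 'a"
  assumes scale_mult_left: "scaleA c a * b = scaleA c (a * b)"
    and scale_mult_right: "a * scaleA c b = scaleA c (a * b)"
    and surjective: "surj (free_eval scaleA \<iota>)"
    and kernel: "free_eval scaleA \<iota> p = 0 \<longleftrightarrow>
                 p \<in> two_sided_ideal (tensor_relations scaleV \<union> square_relations)"

locale exterior_algebra_basis = exterior_algebra scaleV scaleA \<iota>
  for scaleV :: "'k::field \<Rightarrow> 'v::ab_group_add \<Rightarrow> 'v"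
    and scaleA :: "'k \<Rightarrow> 'a::ring_1 \<Rightarrow> 'a"
    and \<iota> :: "'v \<Rightarrow> 'a" +
  fixes n :: nat and x :: "nat \<Rightarrow> 'v"
  assumes basis_inj: "inj_on x {1..n}"
    and basis_independent: "V.independent (x ` {1..n})"
    and basis_span: "V.span (x ` {1..n}) = UNIV"

definition wedge_power ::
    "('k::field \<Rightarrow> 'a::ring_1 \<Rightarrow> 'a) \<Rightarrow> ('v \<Rightarrow> 'a) \<Rightarrow> nat \<Rightarrow> 'a set" where
  "wedge_power scaleA \<iota> i =
     module.span scaleA {prod_list (map \<iota> vs) | vs. length vs = i}"

definition odd_part ::
    "('k::field \<Rightarrow> 'a::ring_1 \<Rightarrow> 'a) \<Rightarrow> ('v \<Rightarrow> 'a) \<Rightarrow> 'a set" where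
  "odd_part scaleA \<iota> = module.span scaleA (\<Union>i\<in>{i. odd i}. wedge_power scaleA \<iota> i)"

definition ext_integral ::
    "('k::field \<Rightarrow> 'a::ring_1 \<Rightarrow> 'a) \<Rightarrow> ('v \<Rightarrow> 'a) \<Rightarrow> nat \<Rightarrow> (nat \<Rightarrow> 'v) \<Rightarrow> 'a \<Rightarrow> 'k" where
  "ext_integral scaleA \<iota> n x =
     (THE f. Vector_Spaces.linear scaleA (*) f \<and>
             (\<forall>i<n. \<forall>a\<in>wedge_power scaleA \<iota> i. f a = 0) \<and>
             f (prod_list (map (\<lambda>i. \<iota> (x i)) [1..<Suc n])) = 1)"

definition frobenius_form ::
    "('k::field \<Rightarrow> 'a::ring_1 \<Rightarrow> 'a) \<Rightarrow> ('v \<Rightarrow> 'a) \<Rightarrow> nat \<Rightarrow> (nat \<Rightarrow> 'v) \<Rightarrow> 'a \<Rightarrow> 'a \<Rightarrow> 'k" where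
  "frobenius_form scaleA \<iota> n x a b = ext_integral scaleA \<iota> n x (a * b)"

text \<open>
  The Nakayama automorphism \<open>\<sigma>\<close> is determined by the form and does not itself occur in the
  identity defining the divergence \<open>div\<^sub>\<sigma>\<close>.
\<close>

definition nakayama_divergence ::
    "('k::field \<Rightarrow> 'a::ring_1 \<Rightarrow> 'a) \<Rightarrow> ('v \<Rightarrow> 'a) \<Rightarrow> nat \<Rightarrow> (nat \<Rightarrow> 'v) \<Rightarrow> ('a \<Rightarrow> 'a) \<Rightarrow> 'a" where
  "nakayama_divergence scaleA \<iota> n x \<delta> =
     (THE d. \<forall>a b. frobenius_form scaleA \<iota> n x (\<delta> a) b + frobenius_form scaleA \<iota> n x a (\<delta> b)
                 = frobenius_form scaleA \<iota> n x a (b * d))"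

definition ad :: "'a::ring_1 \<Rightarrow> 'a \<Rightarrow> 'a" where
  "ad a b = a * b - b * a"

definition left_skew_derivation ::
    "('k::field \<Rightarrow> 'a::ring_1 \<Rightarrow> 'a) \<Rightarrow> ('v \<Rightarrow> 'a) \<Rightarrow> ('a \<Rightarrow> 'a) \<Rightarrow> bool" where
  "left_skew_derivation scaleA \<iota> d \<longleftrightarrow>
     Vector_Spaces.linear scaleA scaleA d \<and>
     (\<forall>i. \<forall>a\<in>wedge_power scaleA \<iota> i. \<forall>b. d (a * b) = d a * b + (- 1) ^ i * a * d b)"

definition ext_partial ::
    "('k::field \<Rightarrow> 'a::ring_1 \<Rightarrow> 'a) \<Rightarrow> ('v \<Rightarrow> 'a) \<Rightarrow> nat \<Rightarrow> (nat \<Rightarrow> 'v) \<Rightarrow> nat \<Rightarrow> 'a \<Rightarrow> 'a" where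
  "ext_partial scaleA \<iota> n x j =
     (THE d. left_skew_derivation scaleA \<iota> d \<and>
             (\<forall>i\<in>{1..n}. d (\<iota> (x i)) = (if i = j then 1 else 0)))"

end

theory Submission
  imports Defs "HOL-Library.Multiset"
begin

text \<open>
  For a derivation \<open>\<delta>\<close> the defining identity of the divergence says \<open>\<integral> \<delta>(c) = \<integral> c \<cdot> div \<delta>\<close> for all
  \<open>c\<close>. For \<open>\<delta> = ad a\<close> with \<open>a\<close> odd, only products of total degree \<open>n\<close> contribute, and there
  graded commutativity gives \<open>ac = (-1)\<^sup>n\<^sup>-\<^sup>1 ca\<close>. For \<open>\<delta> = a\<^sub>i\<partial>\<^sub>i\<close>, integrate
  \<open>\<partial>\<^sub>i(a\<^sub>i c) = \<partial>\<^sub>i(a\<^sub>i) c - a\<^sub>i \<partial>\<^sub>i(c)\<close>: the left-hand side has no component of top degree, and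
  \<open>\<partial>\<^sub>i(a\<^sub>i)\<close> is even, hence central.

  The skew derivations \<open>\<partial>\<^sub>i\<close> are obtained by contraction on the free algebra, which preserves the
  defining ideal. The integral is then \<open>\<epsilon> \<circ> \<partial>\<^sub>n \<circ> \<cdots> \<circ> \<partial>\<^sub>1\<close> with \<open>\<epsilon>\<close> the augmentation, so that no
  determinants are needed to see that \<open>x\<^sub>1 \<and> \<cdots> \<and> x\<^sub>n \<noteq> 0\<close>. The form is nondegenerate because every
  nonzero \<open>d\<close> has a nonzero left multiple killed by all \<open>x\<^sub>j\<close>, and the identity
  \<open>\<partial>\<^sub>j(x\<^sub>j d) + x\<^sub>j \<partial>\<^sub>j(d) = d\<close> turns such an element into a multiple of \<open>x\<^sub>1 \<and> \<cdots> \<and> x\<^sub>n\<close>.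
\<close>

section \<open>Linear maps out of the free algebra\<close>

lemma poly_mapping_single_induct [case_names zero single add]:
  assumes "P 0" and "\<And>k c. P (Poly_Mapping.single k c)"
    and "\<And>p q. P p \<Longrightarrow> P q \<Longrightarrow> P (p + q)"
  shows "P (p :: 'w \<Rightarrow>\<^sub>0 'b::comm_monoid_add)"
proof (induction p rule: update_induct)
  case const
  show ?case by (rule assms(1))
next
  case (update f a b)
  have "Poly_Mapping.update a b f = Poly_Mapping.single a b + f"
    using update(1)
    by (intro poly_mapping_eqI)
      (auto simp: lookup_update lookup_add lookup_single when_def in_keys_iff)
  with update assms show ?case by simp
qed

locale assoc_algebra = vector_space scale
  for scale :: "'k::field \<Rightarrow> 'a::ring_1 \<Rightarrow> 'a" +
  assumes scale_times_left: "scale c a * b = scale c (a * b)"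
    and scale_times_right: "a * scale c b = scale c (a * b)"
begin

text \<open>Evaluation homomorphisms and contraction operators are both linear extensions of a
  function on words, so linearity is treated once for all of them.\<close>

definition free_lin :: "('w \<Rightarrow> 'a) \<Rightarrow> ('w \<Rightarrow>\<^sub>0 'k) \<Rightarrow> 'a" where
  "free_lin g p = (\<Sum>w\<in>Poly_Mapping.keys p. scale (Poly_Mapping.lookup p w) (g w))"

lemma free_lin_superset:
  assumes "finite S" "Poly_Mapping.keys p \<subseteq> S"
  shows "free_lin g p = (\<Sum>w\<in>S. scale (Poly_Mapping.lookup p w) (g w))"
  unfolding free_lin_def using assms
  by (intro sum.mono_neutral_left) (auto simp: in_keys_iff)

lemma free_lin_zero [simp]: "free_lin g 0 = 0"
  by (simp add: free_lin_def)

lemma free_lin_single [simp]: "free_lin g (Poly_Mapping.single w c) = scale c (g w)"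
  by (subst free_lin_superset[of "{w}"]) auto

lemma free_lin_add: "free_lin g (p + q) = free_lin g p + free_lin g q"
proof -
  let ?S = "Poly_Mapping.keys p \<union> Poly_Mapping.keys q"
  have "Poly_Mapping.keys (p + q) \<subseteq> ?S" by (rule keys_add)
  then show ?thesis
    by (simp add: free_lin_superset[of ?S] lookup_add scale_left_distrib sum.distrib)
qed

lemma free_lin_diff: "free_lin g (p - q) = free_lin g p - free_lin g q"
  using free_lin_add[of g "p - q" q] by (simp add: algebra_simps)

text \<open>Two summands cover both uses: multiplicative maps, with the second summand zero, and
  skew Leibniz rules. By additivity in \<open>p\<close> and \<open>q\<close> it is enough to compare
  monomials.\<close>

lemma free_lin_mult:
  assumes "\<And>u w. g (u + w) = g1 u * h1 w + g2 u * h2 w"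
  shows "free_lin g (p * q) = free_lin g1 p * free_lin h1 q + free_lin g2 p * free_lin h2 q"
proof (induction p rule: poly_mapping_single_induct)
  case (single u c)
  show ?case
  proof (induction q rule: poly_mapping_single_induct)
    case (single w d)
    then show ?case
      by (simp add: mult_single assms scale_times_left scale_times_right scale_right_distrib
          scale_left_commute mult.commute)
  qed (simp_all add: free_lin_add distrib_left algebra_simps)
qed (simp_all add: free_lin_add distrib_right algebra_simps)

lemma free_lin_const_mult: "free_lin g (const c * p) = scale c (free_lin g p)"
  by (induction p rule: poly_mapping_single_induct)
    (simp_all add: const_def mult_single free_lin_add distrib_left scale_right_distrib)

lemma free_eval_eq_free_lin:
  "free_eval scale f = free_lin (\<lambda>w. prod_list (map f (letters w)))"
  by (simp add: fun_eq_iff free_eval_def free_lin_def)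

lemma free_eval_mult: "free_eval scale f (p * q) = free_eval scale f p * free_eval scale f q"
  unfolding free_eval_eq_free_lin
  using free_lin_mult[where g = "\<lambda>w. prod_list (map f (letters w))"
      and ?g1.0 = "\<lambda>w. prod_list (map f (letters w))"
      and ?h1.0 = "\<lambda>w. prod_list (map f (letters w))"
      and ?g2.0 = "\<lambda>w. 0" and ?h2.0 = "\<lambda>w. 0"]
  by (simp add: plus_word_def) (simp add: free_lin_def)

lemma free_eval_zero [simp]: "free_eval scale f 0 = 0"
  by (simp add: free_eval_eq_free_lin)

lemma free_eval_add: "free_eval scale f (p + q) = free_eval scale f p + free_eval scale f q"
  by (simp add: free_eval_eq_free_lin free_lin_add)

lemma free_eval_diff: "free_eval scale f (p - q) = free_eval scale f p - free_eval scale f q"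
  by (simp add: free_eval_eq_free_lin free_lin_diff)

lemma free_eval_single:
  "free_eval scale f (Poly_Mapping.single w c) = scale c (prod_list (map f (letters w)))"
  by (simp add: free_eval_eq_free_lin)

lemma free_eval_gen [simp]: "free_eval scale f (gen v) = f v"
  by (simp add: gen_def free_eval_single)

lemma free_eval_const [simp]: "free_eval scale f (const c) = scale c 1"
  by (simp add: const_def free_eval_single zero_word_def)

lemma free_eval_const_mult: "free_eval scale f (const c * p) = scale c (free_eval scale f p)"
  by (simp add: free_eval_eq_free_lin free_lin_const_mult)

lemma neg_one_power_twice: "(-1) ^ m * ((-1) ^ m * a) = a" for a :: 'a
  by (simp add: minus_one_power_iff)

end

text \<open>The ground field as an algebra over itself is the target of the augmentation.\<close>

interpretation field_algebra: assoc_algebra "(*) :: 'k::field \<Rightarrow> 'k \<Rightarrow> 'k"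
  by unfold_locales (simp_all add: algebra_simps)

section \<open>Maps descending to the exterior algebra\<close>

sublocale exterior_algebra \<subseteq> A: assoc_algebra scaleA
  by unfold_locales (simp_all add: scale_mult_left scale_mult_right)

context exterior_algebra
begin

abbreviation ev :: "('v word \<Rightarrow>\<^sub>0 'k) \<Rightarrow> 'a" where
  "ev \<equiv> free_eval scaleA \<iota>"

abbreviation rels :: "('v word \<Rightarrow>\<^sub>0 'k) set" where
  "rels \<equiv> two_sided_ideal (tensor_relations scaleV \<union> square_relations)"

section \<open>Products of vectors and the relations between them\<close>

definition wedge :: "'v list \<Rightarrow> 'a" where
  "wedge vs = prod_list (map \<iota> vs)"

lemma wedge_Nil [simp]: "wedge [] = 1"
  and wedge_Cons: "wedge (v # vs) = \<iota> v * wedge vs"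
  and wedge_append: "wedge (us @ vs) = wedge us * wedge vs"
  by (simp_all add: wedge_def)

lemma iota_add: "\<iota> (u + v) = \<iota> u + \<iota> v"
proof -
  have "gen (u + v) - gen u - gen v \<in> rels"
    by (rule two_sided_ideal.base) (auto simp: tensor_relations_def)
  then have "ev (gen (u + v) - gen u - gen v) = 0" using kernel by blast
  then show ?thesis by (simp add: A.free_eval_diff A.free_eval_add algebra_simps)
qed

lemma iota_scale: "\<iota> (scaleV c v) = scaleA c (\<iota> v)"
proof -
  have "gen (scaleV c v) - const c * gen v \<in> rels"
    by (rule two_sided_ideal.base) (auto simp: tensor_relations_def)
  then have "ev (gen (scaleV c v) - const c * gen v) = 0" using kernel by blast
  then show ?thesis by (simp add: A.free_eval_diff A.free_eval_const_mult)
qed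

lemma iota_square: "\<iota> v * \<iota> v = 0"
proof -
  have "gen v * gen v \<in> rels"
    by (rule two_sided_ideal.base) (auto simp: square_relations_def)
  then have "ev (gen v * gen v) = 0" using kernel by blast
  then show ?thesis by (simp add: A.free_eval_mult)
qed

lemma iota_anticommute: "\<iota> u * \<iota> v = - (\<iota> v * \<iota> u)"
proof -
  have "0 = (\<iota> u + \<iota> v) * (\<iota> u + \<iota> v)"
    using iota_square[of "u + v"] by (simp add: iota_add)
  also have "\<dots> = \<iota> u * \<iota> v + \<iota> v * \<iota> u"
    by (simp add: distrib_left distrib_right iota_square)
  finally show ?thesis by (simp add: eq_neg_iff_add_eq_0)
qed

lemma linear_iota: "Vector_Spaces.linear scaleV scaleA \<iota>"
  unfolding Vector_Spaces.linear_iff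
  by (simp add: iota_add iota_scale V.vector_space_axioms A.vector_space_axioms)

lemma ev_inv [simp]: "ev (inv ev a) = a"
  using surjective by (rule surj_f_inv_f)

text \<open>The kernel of \<open>ev\<close> is \<open>rels\<close>, so \<open>L\<close> is constant
  on the fibres of \<open>ev\<close> and the preimage chosen by \<open>inv ev\<close> does not
  matter.\<close>

lemma descend:
  assumes diff: "\<And>p q. L (p - q) = L p - (L q :: 'b::ab_group_add)"
    and vanish: "\<And>p. p \<in> rels \<Longrightarrow> L p = 0"
  shows "L (inv ev (ev p)) = L p"
proof -
  have "ev (inv ev (ev p) - p) = 0" by (simp add: A.free_eval_diff)
  then have "L (inv ev (ev p) - p) = 0" using kernel vanish by blast
  then show ?thesis by (simp add: diff)
qed

lemma linear_descend:
  assumes "vector_space s"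
    and add: "\<And>p q. L (p + q) = L p + (L q :: 'b::ab_group_add)"
    and scale: "\<And>c p. L (const c * p) = s c (L p)"
    and vanish: "\<And>p. p \<in> rels \<Longrightarrow> L p = 0"
  shows "Vector_Spaces.linear scaleA s (\<lambda>a. L (inv ev a))"
proof -
  have diff: "L (p - q) = L p - L q" for p q
    using add[of "p - q" q] by (simp add: algebra_simps)
  note desc = descend[of L, OF diff vanish]
  have "L (inv ev (a + b)) = L (inv ev a) + L (inv ev b)" for a b
    using desc[of "inv ev a + inv ev b"] by (simp add: A.free_eval_add add)
  moreover have "L (inv ev (scaleA c a)) = s c (L (inv ev a))" for c a
    using desc[of "const c * inv ev a"] by (simp add: A.free_eval_const_mult scale)
  ultimately show ?thesis
    using assms(1) A.vector_space_axioms by (simp add: Vector_Spaces.linear_iff)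
qed

lemma ev_word: "ev (Poly_Mapping.single (Word vs) 1) = wedge vs"
  by (simp add: A.free_eval_single wedge_def)

section \<open>Induction over products of vectors\<close>

lemma span_wedge: "a \<in> A.span (range wedge)"
proof -
  have "ev (inv ev a) \<in> A.span (range wedge)"
    unfolding free_eval_def
    by (intro A.span_sum A.span_scale A.span_base) (auto simp: wedge_def)
  then show ?thesis by simp
qed

lemma wedge_induct [case_names zero step]:
  assumes "P 0" and "\<And>c vs a. P a \<Longrightarrow> P (scaleA c (wedge vs) + a)"
  shows "P a"
  using span_wedge[of a]
  by (induction a rule: A.span_induct_alt) (use assms in auto)

lemma wedge_in_wedge_power: "wedge vs \<in> wedge_power scaleA \<iota> (length vs)"
  unfolding wedge_power_def wedge_def by (rule A.span_base) auto

lemma wedge_power_induct [consumes 1, case_names zero step]: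
  assumes "a \<in> wedge_power scaleA \<iota> m" "P 0"
    and "\<And>c vs a. length vs = m \<Longrightarrow> P a \<Longrightarrow> P (scaleA c (wedge vs) + a)"
  shows "P a"
  using assms(1) unfolding wedge_power_def
  by (induction a rule: A.span_induct_alt) (use assms(2,3) in \<open>auto simp: wedge_def\<close>)

text \<open>The nested spans in \<open>odd_part\<close> collapse to a single span of words of odd
  length.\<close>

lemma odd_part_induct [consumes 1, case_names zero step]:
  assumes "a \<in> odd_part scaleA \<iota>" "P 0"
    and "\<And>c vs a. odd (length vs) \<Longrightarrow> P a \<Longrightarrow> P (scaleA c (wedge vs) + a)"
  shows "P a"
proof -
  have "odd_part scaleA \<iota> \<subseteq> A.span {wedge vs |vs. odd (length vs)}"
    unfolding odd_part_def wedge_power_def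
    by (intro A.span_minimal UN_least A.span_mono A.subspace_span)
      (auto simp: wedge_def)
  with assms(1) have "a \<in> A.span {wedge vs |vs. odd (length vs)}" by blast
  then show ?thesis
    by (induction a rule: A.span_induct_alt) (use assms(2,3) in auto)
qed

section \<open>Graded commutativity\<close>

lemma iota_wedge_commute: "\<iota> u * wedge vs = (-1) ^ length vs * (wedge vs * \<iota> u)"
proof (induction vs)
  case (Cons v vs)
  have "\<iota> u * wedge (v # vs) = - (\<iota> v * (\<iota> u * wedge vs))"
    by (simp add: wedge_Cons mult.assoc[symmetric] iota_anticommute[of u v])
  with Cons show ?case
    by (simp add: wedge_Cons mult.assoc minus_one_power_iff)
qed simp

lemma wedge_commute:
  "wedge us * wedge vs = (-1) ^ (length us * length vs) * (wedge vs * wedge us)"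
proof (induction us)
  case (Cons u us)
  have "wedge (u # us) * wedge vs =
      (-1) ^ (length us * length vs) * ((\<iota> u * wedge vs) * wedge us)"
    by (simp add: wedge_Cons mult.assoc Cons minus_one_power_iff)
  then show ?case
    by (simp add: iota_wedge_commute power_add wedge_Cons mult.assoc minus_one_power_iff)
qed simp

lemma odd_wedge_commute:
  assumes "a \<in> odd_part scaleA \<iota>"
  shows "a * wedge vs = (-1) ^ length vs * (wedge vs * a)"
  using assms
proof (induction a rule: odd_part_induct)
  case (step c us a)
  then show ?case
    by (simp add: distrib_left distrib_right wedge_commute[of us vs] scale_mult_left
        scale_mult_right minus_one_power_iff split: if_splits)
qed simp

lemma even_commute:
  assumes "even (length us)"
  shows "wedge us * a = a * wedge us"
  by (induction a rule: wedge_induct)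
    (use assms in \<open>simp_all add: distrib_left distrib_right wedge_commute[of us] scale_mult_left
        scale_mult_right\<close>)

text \<open>The algebra homomorphism to the field that kills all of V, that is, the projection to
  the component of degree 0. It descends because no defining relation has a constant term.\<close>

definition augmentation :: "'a \<Rightarrow> 'k" where
  "augmentation a = free_eval (*) (\<lambda>v. 0) (inv ev a)"

lemma free_eval_zero_rels: "p \<in> rels \<Longrightarrow> free_eval (*) (\<lambda>v. 0) p = 0"
proof (induction p rule: two_sided_ideal.induct)
  case (base s)
  then show ?case
    by (auto simp: tensor_relations_def square_relations_def field_algebra.free_eval_diff
        field_algebra.free_eval_const_mult field_algebra.free_eval_mult)
qed (simp_all add: field_algebra.free_eval_add field_algebra.free_eval_mult)

lemma linear_augmentation: "Vector_Spaces.linear scaleA (*) augmentation"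
  unfolding augmentation_def
  by (rule linear_descend)
    (simp_all add: field_algebra.vector_space_axioms field_algebra.free_eval_add
      field_algebra.free_eval_const_mult free_eval_zero_rels)

lemma augmentation_one: "augmentation 1 = 1"
proof -
  have "augmentation (ev (Poly_Mapping.single (Word []) 1)) = 1"
    unfolding augmentation_def
    by (subst descend) (simp_all add: field_algebra.free_eval_diff free_eval_zero_rels
        field_algebra.free_eval_single)
  then show ?thesis by (simp add: ev_word)
qed

section \<open>Repeated and permuted factors\<close>

lemma iota_wedge_zero: "v \<in> set vs \<Longrightarrow> \<iota> v * wedge vs = 0"
proof (induction vs)
  case (Cons u vs)
  show ?case
  proof (cases "u = v")
    case True
    then show ?thesis by (simp add: wedge_Cons mult.assoc[symmetric] iota_square)
  next
    case False
    have "\<iota> v * wedge (u # vs) = - (\<iota> u * (\<iota> v * wedge vs))"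
      by (simp add: wedge_Cons mult.assoc[symmetric] iota_anticommute[of v u])
    with False Cons show ?thesis by simp
  qed
qed simp

lemma wedge_not_distinct: "\<not> distinct vs \<Longrightarrow> wedge vs = 0"
  by (induction vs) (auto simp: wedge_Cons iota_wedge_zero)

text \<open>Leaving the sign undetermined avoids signs of permutations; the disjunction is enough to
  compare linear forms that agree on one ordering.\<close>

lemma wedge_mset_eq:
  "mset us = mset vs \<Longrightarrow> wedge us = wedge vs \<or> wedge us = - wedge vs"
proof (induction us arbitrary: vs)
  case (Cons u us)
  then have "u \<in> set vs" by (metis list.set_intros(1) mset_eq_setD)
  then obtain vs1 vs2 where vs: "vs = vs1 @ u # vs2" by (meson split_list)
  with Cons.prems have "mset us = mset (vs1 @ vs2)" by simp
  from Cons.IH[OF this] have "wedge us = wedge (vs1 @ vs2) \<or> wedge us = - wedge (vs1 @ vs2)" .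
  \<comment> \<open>Moving \<open>u\<close> to the front past \<open>vs1\<close> costs one sign per
    letter.\<close>
  moreover have "wedge vs = wedge (u # vs1 @ vs2) \<or> wedge vs = - wedge (u # vs1 @ vs2)"
  proof -
    have "wedge (u # vs1 @ vs2) = (-1) ^ length vs1 * wedge vs"
      by (simp add: vs wedge_Cons wedge_append mult.assoc[symmetric] iota_wedge_commute[of u vs1])
    then show ?thesis by (simp add: minus_one_power_iff split: if_splits)
  qed
  ultimately show ?case by (auto simp: wedge_Cons)
qed simp

lemma span_mult:
  assumes "a \<in> A.span S" "b \<in> A.span T"
    and "\<And>s t. s \<in> S \<Longrightarrow> t \<in> T \<Longrightarrow> s * t \<in> A.span U"
  shows "a * b \<in> A.span U"
  using assms(1)
proof (induction a rule: A.span_induct_alt)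
  case base
  then show ?case by (simp add: A.span_zero)
next
  case (step c s a)
  have "s * b \<in> A.span U"
    using assms(2)
  proof (induction b rule: A.span_induct_alt)
    case base
    then show ?case by (simp add: A.span_zero)
  next
    case (step d t b)
    then show ?case
      using assms(3)[OF \<open>s \<in> S\<close>]
      by (simp add: distrib_left scale_mult_right A.span_add A.span_scale)
  qed
  with step show ?case
    by (simp add: distrib_right scale_mult_left A.span_add A.span_scale)
qed

end

section \<open>Skew derivations and the integral\<close>

context exterior_algebra_basis
begin

section \<open>Contraction and partial derivatives\<close>

definition coord :: "nat \<Rightarrow> 'v \<Rightarrow> 'k" where
  "coord j v = V.representation (x ` {1..n}) v (x j)"

lemma coord_add: "coord j (u + v) = coord j u + coord j v"
  using basis_independent basis_span by (simp add: coord_def V.representation_add)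

lemma coord_scale: "coord j (scaleV c v) = c * coord j v"
  using basis_independent basis_span by (simp add: coord_def V.representation_scale)

lemma coord_basis:
  "i \<in> {1..n} \<Longrightarrow> j \<in> {1..n} \<Longrightarrow> coord j (x i) = (if i = j then 1 else 0)"
  using basis_independent basis_inj
  by (auto simp: coord_def V.representation_basis inj_on_eq_iff)

text \<open>Interior product of a word with the coordinate functional \<open>coord j\<close>; the
  recursion is the skew Leibniz rule for splitting off the first letter.\<close>

primrec contract :: "nat \<Rightarrow> 'v list \<Rightarrow> 'a" where
  "contract j [] = 0"
| "contract j (v # vs) = scaleA (coord j v) (wedge vs) - \<iota> v * contract j vs"

lemma wedge_uminus: "prod_list (map (\<lambda>v. - \<iota> v) vs) = (-1) ^ length vs * wedge vs"
  by (induction vs) (simp_all add: wedge_Cons minus_one_power_iff)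

text \<open>The sign is written as the product of the -\<iota> v because in this form it is
  multiplicative in \<open>us\<close> and extends to an algebra homomorphism on the free
  algebra.\<close>

lemma contract_append:
  "contract j (us @ vs) =
     contract j us * wedge vs + prod_list (map (\<lambda>v. - \<iota> v) us) * contract j vs"
  by (induction us)
    (simp_all add: wedge_append scale_mult_left algebra_simps)

definition free_partial :: "nat \<Rightarrow> ('v word \<Rightarrow>\<^sub>0 'k) \<Rightarrow> 'a" where
  "free_partial j = A.free_lin (\<lambda>w. contract j (letters w))"

lemma free_partial_mult:
  "free_partial j (p * q) =
     free_partial j p * ev q + free_eval scaleA (\<lambda>v. - \<iota> v) p * free_partial j q"
  unfolding free_partial_def A.free_eval_eq_free_lin
  by (rule A.free_lin_mult) (simp add: plus_word_def contract_append wedge_def)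

lemma free_partial_gen: "free_partial j (gen v) = scaleA (coord j v) 1"
  by (simp add: free_partial_def gen_def)

text \<open>
  The kernel of the sign-twisted evaluation enters because the skew Leibniz rule applies it to the
  left factor.
\<close>

lemma free_partial_rels:
  assumes "p \<in> rels"
  shows "ev p = 0 \<and> free_eval scaleA (\<lambda>v. - \<iota> v) p = 0 \<and> free_partial j p = 0"
  using assms
proof (induction p rule: two_sided_ideal.induct)
  case (base s)
  have "ev s = 0" using kernel two_sided_ideal.base[OF base] by blast
  moreover have "free_eval scaleA (\<lambda>v. - \<iota> v) s = 0"
    using base
    by (auto simp: tensor_relations_def square_relations_def A.free_eval_diff A.free_eval_mult
        iota_add iota_scale iota_square scale_mult_left)
  \<comment> \<open>On a square \<open>gen v * gen v\<close> the two Leibniz terms are the same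
    scalar multiple of \<iota> v with opposite signs.\<close>
  moreover have "free_partial j s = 0"
    using base
    by (auto simp: tensor_relations_def square_relations_def free_partial_mult free_partial_gen
        coord_add coord_scale scale_mult_left scale_mult_right)
      (simp_all add: free_partial_def A.free_lin_diff A.free_lin_const_mult gen_def
        coord_add coord_scale A.scale_left_distrib)
  ultimately show ?case by simp
qed (simp_all add: A.free_eval_add A.free_eval_mult free_partial_mult,
    simp_all add: free_partial_def A.free_lin_add)

definition partial :: "nat \<Rightarrow> 'a \<Rightarrow> 'a" where
  "partial j a = free_partial j (inv ev a)"

lemma linear_partial: "Vector_Spaces.linear scaleA scaleA (partial j)"
  unfolding partial_def
  by (rule linear_descend) (use free_partial_rels in \<open>auto simp: A.vector_space_axioms
      free_partial_def A.free_lin_add A.free_lin_const_mult\<close>)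

lemma partial_add: "partial j (a + b) = partial j a + partial j b"
  and partial_scale: "partial j (scaleA c a) = scaleA c (partial j a)"
  using linear_partial by (simp_all add: Vector_Spaces.linear_iff)

lemma partial_zero [simp]: "partial j 0 = 0"
  using partial_add[of j 0 0] by simp

lemma partial_wedge: "partial j (wedge vs) = contract j vs"
proof -
  have "partial j (ev (Poly_Mapping.single (Word vs) 1)) = contract j vs"
    unfolding partial_def
    by (subst descend) (use free_partial_rels in \<open>auto simp: free_partial_def A.free_lin_diff\<close>)
  then show ?thesis by (simp add: ev_word)
qed

lemma partial_one [simp]: "partial j 1 = 0"
  using partial_wedge[of j "[]"] by simp

lemma partial_wedge_mult:
  "partial j (wedge vs * a) = contract j vs * a + (-1) ^ length vs * (wedge vs * partial j a)"
proof (induction a rule: wedge_induct)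
  case (step c us a)
  have "partial j (wedge vs * wedge us) =
      contract j vs * wedge us + (-1) ^ length vs * (wedge vs * contract j us)"
    using partial_wedge[of j "vs @ us"]
    by (simp add: wedge_append contract_append wedge_uminus mult.assoc)
  with step show ?case
    by (simp add: distrib_left partial_add scale_mult_right partial_scale partial_wedge
        A.scale_right_distrib algebra_simps)
qed simp

lemma partial_iota_mult:
  "partial j (\<iota> v * a) = scaleA (coord j v) a - \<iota> v * partial j a"
  using partial_wedge_mult[of j "[v]" a] by (simp add: wedge_Cons scale_mult_left)

lemma left_skew_derivation_partial: "left_skew_derivation scaleA \<iota> (partial j)"
  unfolding left_skew_derivation_def
proof (intro conjI linear_partial allI ballI)
  fix i a b
  assume "a \<in> wedge_power scaleA \<iota> i"
  then show "partial j (a * b) = partial j a * b + (-1) ^ i * a * partial j b"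
  proof (induction a rule: wedge_power_induct)
    case (step c vs a)
    then show ?case
      by (simp add: distrib_left distrib_right partial_add scale_mult_left scale_mult_right
          partial_scale partial_wedge_mult partial_wedge A.scale_right_distrib mult.assoc)
  qed simp
qed

lemma span_iota: "\<iota> v \<in> A.span ((\<lambda>i. \<iota> (x i)) ` {1..n})"
proof -
  have "module_hom scaleV scaleA \<iota>"
    using linear_iota by (simp add: module_hom_iff_linear)
  then have "A.span (\<iota> ` x ` {1..n}) = \<iota> ` V.span (x ` {1..n})"
    by (rule module_hom.span_image)
  then show ?thesis using basis_span by (simp add: image_image)
qed

text \<open>A skew derivation kills 1, and the Leibniz rule for a first factor from V then computes
  it recursively on words from its values on the basis.\<close>

lemma left_skew_derivation_eqI:
  assumes d: "left_skew_derivation scaleA \<iota> d" and e: "left_skew_derivation scaleA \<iota> e"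
    and eq: "\<And>i. i \<in> {1..n} \<Longrightarrow> d (\<iota> (x i)) = e (\<iota> (x i))"
  shows "d = e"
proof -
  have pair: "vector_space_pair scaleA scaleA"
    by (simp add: vector_space_pair_def A.vector_space_axioms)
  have lin: "Vector_Spaces.linear scaleA scaleA d" "Vector_Spaces.linear scaleA scaleA e"
    using d e by (auto simp: left_skew_derivation_def)
  have one: "f 1 = 0" if "left_skew_derivation scaleA \<iota> f" for f
  proof -
    \<comment> \<open>Since 1 has degree 0, the rule carries no sign here and reads f(1) = f(1) +
      f(1).\<close>
    have "f (1 * 1) = f 1 * 1 + (-1) ^ 0 * 1 * f 1"
      using that wedge_in_wedge_power[of "[]"] unfolding left_skew_derivation_def
      by (metis list.size(3) wedge_Nil)
    then show ?thesis by simp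
  qed
  have iota: "d (\<iota> v) = e (\<iota> v)" for v
    by (rule vector_space_pair.linear_eq_on[OF pair lin span_iota]) (use eq in auto)
  have cons: "f (\<iota> v * b) = f (\<iota> v) * b - \<iota> v * f b"
    if "left_skew_derivation scaleA \<iota> f" for f v b
  proof -
    have "\<iota> v \<in> wedge_power scaleA \<iota> 1"
      using wedge_in_wedge_power[of "[v]"] by (simp add: wedge_Cons)
    with that have "f (\<iota> v * b) = f (\<iota> v) * b + (-1) ^ 1 * \<iota> v * f b"
      unfolding left_skew_derivation_def by blast
    then show ?thesis by simp
  qed
  have wedge: "d (wedge vs) = e (wedge vs)" for vs
    by (induction vs) (simp_all add: wedge_Cons one d e cons iota)
  have "d a = e a" for a
    by (rule vector_space_pair.linear_eq_on[OF pair lin span_wedge]) (auto simp: wedge)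
  then show ?thesis by (simp add: fun_eq_iff)
qed

lemma partial_basis:
  "i \<in> {1..n} \<Longrightarrow> j \<in> {1..n} \<Longrightarrow> partial j (\<iota> (x i)) = (if i = j then 1 else 0)"
  using partial_wedge[of j "[x i]"] by (simp add: wedge_Cons coord_basis)

lemma ext_partial_eq:
  assumes "j \<in> {1..n}"
  shows "ext_partial scaleA \<iota> n x j = partial j"
  unfolding ext_partial_def
proof (rule the_equality)
  show "left_skew_derivation scaleA \<iota> (partial j) \<and>
      (\<forall>i\<in>{1..n}. partial j (\<iota> (x i)) = (if i = j then 1 else 0))"
    using left_skew_derivation_partial partial_basis assms by blast
next
  fix d
  assume "left_skew_derivation scaleA \<iota> d \<and>
      (\<forall>i\<in>{1..n}. d (\<iota> (x i)) = (if i = j then 1 else 0))"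
  then show "d = partial j"
    using left_skew_derivation_partial partial_basis assms
    by (intro left_skew_derivation_eqI) auto
qed

section \<open>Behaviour of the partial derivatives under the grading\<close>

lemma subspace_wedge_power: "A.subspace (wedge_power scaleA \<iota> m)"
  by (simp add: wedge_power_def)

text \<open>For the empty word the truncated subtraction gives degree 0, which is harmless because
  its contraction is zero.\<close>

lemma contract_wedge_power:
  "contract j vs \<in> wedge_power scaleA \<iota> (length vs - 1)"
proof (induction vs)
  case Nil
  then show ?case using A.subspace_0[OF subspace_wedge_power] by simp
next
  case (Cons v vs)
  have "\<iota> v * contract j vs \<in> wedge_power scaleA \<iota> (length vs)"
  proof (cases vs)
    case Nil
    then show ?thesis using A.subspace_0[OF subspace_wedge_power] by simp
  next
    case (Cons u us)
    have "a \<in> wedge_power scaleA \<iota> m \<Longrightarrow> \<iota> v * a \<in> wedge_power scaleA \<iota> (Suc m)" for a m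
    proof (induction a rule: wedge_power_induct)
      case zero
      then show ?case using A.subspace_0[OF subspace_wedge_power] by simp
    next
      case (step c ws a)
      then show ?case
        using wedge_in_wedge_power[of "v # ws"]
        by (simp add: distrib_left scale_mult_right wedge_Cons
            A.subspace_add[OF subspace_wedge_power] A.subspace_scale[OF subspace_wedge_power])
    qed
    with Cons.IH \<open>vs = u # us\<close> show ?thesis by simp
  qed
  then show ?case
    using wedge_in_wedge_power[of vs]
    by (simp add: A.subspace_diff[OF subspace_wedge_power]
        A.subspace_scale[OF subspace_wedge_power])
qed

lemma partial_wedge_power:
  assumes "a \<in> wedge_power scaleA \<iota> m"
  shows "partial j a \<in> wedge_power scaleA \<iota> (m - 1)"
  using assms
proof (induction a rule: wedge_power_induct)
  case zero
  then show ?case using A.subspace_0[OF subspace_wedge_power] by simp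
next
  case (step c vs a)
  then show ?case
    using contract_wedge_power[of j vs]
    by (simp add: partial_add partial_scale partial_wedge
        A.subspace_add[OF subspace_wedge_power] A.subspace_scale[OF subspace_wedge_power])
qed

text \<open>Degree 0 needs its own statement, since \<open>m - 1\<close> truncates to 0 there and
  the degree bound alone does not yield vanishing.\<close>

lemma partial_wedge_power_0:
  assumes "a \<in> wedge_power scaleA \<iota> 0"
  shows "partial j a = 0"
  using assms
  by (induction a rule: wedge_power_induct) (simp_all add: partial_add partial_scale partial_wedge)

lemma linear_fold_partial: "Vector_Spaces.linear scaleA scaleA (fold partial js)"
  unfolding Vector_Spaces.linear_iff
  by (induction js) (simp_all add: A.vector_space_axioms partial_add partial_scale)

lemma fold_partial_zero: "fold partial js 0 = 0"
  by (induction js) simp_all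

text \<open>Each derivative lowers the degree by one, so degree 0 is reached while at least one
  derivative remains, and that one kills the element.\<close>

lemma fold_partial_low_degree:
  "a \<in> wedge_power scaleA \<iota> m \<Longrightarrow> m < length js \<Longrightarrow> fold partial js a = 0"
proof (induction js arbitrary: a m)
  case (Cons j js)
  show ?case
  proof (cases m)
    case 0
    with Cons show ?thesis by (simp add: partial_wedge_power_0 fold_partial_zero)
  next
    case (Suc k)
    with Cons show ?thesis using partial_wedge_power[of a m j] by simp
  qed
qed simp

lemma contract_basis:
  assumes "j \<in> {1..n}" "set is \<subseteq> {1..n}" "j \<notin> set is"
  shows "contract j (map x is) = 0"
  using assms(2,3) by (induction "is") (use assms(1) in \<open>auto simp: coord_basis\<close>)

text \<open>\<open>fold\<close> applies the first index first, so each derivative strips the leading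
  letter; its index does not occur later, and the other Leibniz terms vanish.\<close>

lemma fold_partial_basis:
  "set is \<subseteq> {1..n} \<Longrightarrow> distinct is \<Longrightarrow> fold partial is (wedge (map x is)) = 1"
proof (induction "is")
  case (Cons i "is")
  then show ?case by (simp add: partial_wedge coord_basis contract_basis)
qed simp

section \<open>The integral as an iterated derivative\<close>

definition top_form :: 'a where
  "top_form = wedge (map x [1..<Suc n])"

definition top_coeff :: "'a \<Rightarrow> 'k" where
  "top_coeff a = augmentation (fold partial [1..<Suc n] a)"

lemma linear_top_coeff: "Vector_Spaces.linear scaleA (*) top_coeff"
  using linear_fold_partial[of "[1..<Suc n]"] linear_augmentation
  unfolding Vector_Spaces.linear_iff top_coeff_def by simp

lemma top_coeff_top_form: "top_coeff top_form = 1"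
  unfolding top_coeff_def top_form_def
  by (subst fold_partial_basis) (auto simp: augmentation_one)

lemma top_coeff_add: "top_coeff (a + b) = top_coeff a + top_coeff b"
  and top_coeff_scale: "top_coeff (scaleA c a) = c * top_coeff a"
  using linear_top_coeff by (simp_all add: Vector_Spaces.linear_iff)

lemma top_coeff_zero [simp]: "top_coeff 0 = 0"
  using top_coeff_scale[of 0 0] by simp

lemma top_coeff_diff: "top_coeff (a - b) = top_coeff a - top_coeff b"
  using top_coeff_add[of "a - b" b] by simp

lemma top_coeff_uminus: "top_coeff (- a) = - top_coeff a"
  using top_coeff_diff[of 0 a] by simp

lemma top_coeff_sum: "top_coeff (\<Sum>i\<in>I. f i) = (\<Sum>i\<in>I. top_coeff (f i))"
  by (induction I rule: infinite_finite_induct) (simp_all add: top_coeff_add)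

lemma top_coeff_low_degree: "a \<in> wedge_power scaleA \<iota> m \<Longrightarrow> m < n \<Longrightarrow> top_coeff a = 0"
  using linear_augmentation top_coeff_zero
  unfolding top_coeff_def by (subst fold_partial_low_degree) (auto simp: fold_partial_zero)

text \<open>Multilinear expansion in the basis. Repeated and unordered indices are kept, so no
  normal form of basis words is required.\<close>

lemma wedge_in_span_basis:
  "wedge vs \<in> A.span {wedge (map x is) |is. length is = length vs \<and> set is \<subseteq> {1..n}}"
proof (induction vs)
  case Nil
  show ?case by (rule A.span_base) auto
next
  case (Cons v vs)
  show ?case
    unfolding wedge_Cons
  proof (rule span_mult[OF span_iota Cons])
    fix s t
    assume "s \<in> (\<lambda>i. \<iota> (x i)) ` {1..n}"
      and "t \<in> {wedge (map x is) |is. length is = length vs \<and> set is \<subseteq> {1..n}}"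
    then obtain i "is" where "i \<in> {1..n}" "length is = length vs" "set is \<subseteq> {1..n}"
      "s = \<iota> (x i)" "t = wedge (map x is)" by blast
    then show "s * t \<in>
        A.span {wedge (map x is) |is. length is = length (v # vs) \<and> set is \<subseteq> {1..n}}"
      by (intro A.span_base CollectI exI[of _ "i # is"]) (auto simp: wedge_Cons)
  qed
qed

lemma wedge_basis_long:
  assumes "length is > n" "set is \<subseteq> {1..n}"
  shows "wedge (map x is) = 0"
proof -
  have "\<not> distinct is"
    using assms card_mono[of "{1..n}" "set is"] by (auto simp: distinct_card)
  then show ?thesis by (intro wedge_not_distinct) (simp add: distinct_map)
qed

text \<open>A list of n indices from 1 to n either repeats one, giving 0, or is a permutation of all
  of them.\<close>

lemma wedge_basis_top:
  assumes "length is = n" "set is \<subseteq> {1..n}"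
  shows "wedge (map x is) \<in> {0, top_form, - top_form}"
proof (cases "distinct is")
  case True
  then have "card (set is) = card {1..n}" using assms by (simp add: distinct_card)
  with assms have "set is = {1..n}" by (intro card_subset_eq) auto
  then have "set is = set [1..<Suc n]"
    by (simp only: set_upt atLeastLessThanSuc_atLeastAtMost)
  then have "mset is = mset [1..<Suc n]"
    using set_eq_iff_mset_eq_distinct[OF True distinct_upt] by blast
  then have "mset (map x is) = mset (map x [1..<Suc n])" by (simp only: mset_map)
  from wedge_mset_eq[OF this] show ?thesis by (auto simp: top_form_def)
next
  case False
  then show ?thesis using wedge_not_distinct[of "map x is"] by (simp add: distinct_map)
qed

lemma wedge_long:
  assumes "length vs > n"
  shows "wedge vs = 0"
proof -
  have "{wedge (map x is) |is. length is = length vs \<and> set is \<subseteq> {1..n}} \<subseteq> {0}"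
    using assms wedge_basis_long by auto
  with wedge_in_span_basis[of vs] have "wedge vs \<in> A.span {0}"
    using A.span_mono by blast
  then show ?thesis by simp
qed

lemma top_coeff_wedge: "length vs \<noteq> n \<Longrightarrow> top_coeff (wedge vs) = 0"
  using top_coeff_low_degree[OF wedge_in_wedge_power[of vs]] wedge_long[of vs]
  by (cases "length vs < n") auto

text \<open>For uniqueness, words shorter than n are killed by assumption, longer ones are zero, and
  those of length n expand into multiples of \<open>top_form\<close>, where the value is
  prescribed.\<close>

lemma ext_integral_eq: "ext_integral scaleA \<iota> n x = top_coeff"
  unfolding ext_integral_def
proof (rule the_equality)
  have top: "prod_list (map (\<lambda>i. \<iota> (x i)) [1..<Suc n]) = top_form"
    by (simp only: top_form_def wedge_def map_map comp_def)
  then show "Vector_Spaces.linear scaleA (*) top_coeff \<and>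
      (\<forall>i<n. \<forall>a\<in>wedge_power scaleA \<iota> i. top_coeff a = 0) \<and>
      top_coeff (prod_list (map (\<lambda>i. \<iota> (x i)) [1..<Suc n])) = 1"
    using linear_top_coeff top_coeff_low_degree top_coeff_top_form by simp
  fix f
  assume f: "Vector_Spaces.linear scaleA (*) f \<and>
      (\<forall>i<n. \<forall>a\<in>wedge_power scaleA \<iota> i. f a = 0) \<and>
      f (prod_list (map (\<lambda>i. \<iota> (x i)) [1..<Suc n])) = 1"
  then interpret f: Vector_Spaces.linear scaleA "(*)" f by blast
  have pair: "vector_space_pair scaleA ((*) :: 'k \<Rightarrow> 'k \<Rightarrow> 'k)"
    by (simp add: vector_space_pair_def A.vector_space_axioms field_algebra.vector_space_axioms)
  have lin: "Vector_Spaces.linear scaleA (*) f" using f by blast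
  note eqI = vector_space_pair.linear_eq_on[OF pair lin linear_top_coeff]
  have ftop: "f top_form = 1" using f top by simp
  have wedge: "f (wedge vs) = top_coeff (wedge vs)" for vs
  proof -
    consider "length vs < n" | "length vs > n" | "length vs = n" by linarith
    then show ?thesis
    proof cases
      case 1
      then show ?thesis
        using f wedge_in_wedge_power[of vs] top_coeff_wedge[of vs] by auto
    next
      case 2
      then show ?thesis by (simp add: wedge_long f.zero)
    next
      case 3
      show ?thesis
      proof (rule eqI[OF wedge_in_span_basis])
        fix b
        assume "b \<in> {wedge (map x is) |is. length is = length vs \<and> set is \<subseteq> {1..n}}"
        with 3 have "b \<in> {0, top_form, - top_form}" using wedge_basis_top by auto
        then show "f b = top_coeff b"
          by (auto simp: f.zero f.neg ftop top_coeff_top_form top_coeff_uminus)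
      qed
    qed
  qed
  have "f a = top_coeff a" for a
    by (rule eqI[OF span_wedge]) (auto simp: wedge)
  then show "f = top_coeff" by (simp add: fun_eq_iff)
qed

section \<open>Nondegeneracy of the Frobenius form\<close>

text \<open>Any factor of positive degree pushes the product beyond degree n, so only the constant
  term of \<open>a\<close> survives.\<close>

lemma top_form_mult: "\<exists>c. top_form * a = scaleA c top_form"
proof (induction a rule: wedge_induct)
  case zero
  show ?case by (rule exI[of _ 0]) simp
next
  case (step c vs a)
  then obtain d where d: "top_form * a = scaleA d top_form" by blast
  show ?case
  proof (cases vs)
    case Nil
    with d show ?thesis
      by (intro exI[of _ "c + d"]) (simp add: distrib_left scale_mult_right A.scale_left_distrib)
  next
    case (Cons v us)
    then have "top_form * wedge vs = 0"
      unfolding top_form_def wedge_append[symmetric] by (intro wedge_long) simp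
    with d show ?thesis
      by (intro exI[of _ d]) (simp add: distrib_left scale_mult_right)
  qed
qed

text \<open>The factors x_1, ..., x_k are split off one at a time, each new one being appended at
  the right end of the word found so far.\<close>

lemma annihilated_multiple:
  assumes "\<And>j. j \<in> {1..n} \<Longrightarrow> \<iota> (x j) * d = 0" "k \<le> n"
  shows "\<exists>e. d = wedge (map x [1..<Suc k]) * e"
  using assms(2)
proof (induction k)
  case (Suc k)
  let ?w = "wedge (map x [1..<Suc k])" and ?j = "Suc k"
  have j: "?j \<in> {1..n}" using Suc.prems by simp
  from Suc obtain e where e: "d = ?w * e" by auto
  have "partial ?j (\<iota> (x ?j) * d) = 0" using assms(1)[OF j] by simp
  then have "d = \<iota> (x ?j) * partial ?j d"
    using j by (simp add: partial_iota_mult coord_basis)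
  \<comment> \<open>The word \<open>?w\<close> involves only x_1, ..., x_k, so its own derivative in
    direction k + 1 vanishes and only the term differentiating \<open>e\<close> remains.\<close>
  also have "partial ?j d = (-1) ^ k * (?w * partial ?j e)"
    unfolding e partial_wedge_mult using j Suc.prems
    by (subst contract_basis) (auto simp del: upt_Suc)
  also have "\<iota> (x ?j) * \<dots> = ((-1) ^ k * (\<iota> (x ?j) * ?w)) * partial ?j e"
    by (simp add: mult.assoc minus_one_power_iff del: upt_Suc)
  \<comment> \<open>Moving the new letter past the k letters of \<open>?w\<close> produces the same
    sign again, and the two cancel.\<close>
  also have "(-1) ^ k * (\<iota> (x ?j) * ?w) = ?w * \<iota> (x ?j)"
    by (simp add: iota_wedge_commute A.neg_one_power_twice del: upt_Suc)
  also have "\<dots> = wedge (map x [1..<Suc ?j])"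
    using wedge_append[of "map x [1..<Suc k]" "[x ?j]"] by (simp add: wedge_Cons)
  finally show ?case by blast
qed simp

text \<open>If the next x_j does not kill the current multiple, multiply by it: the new element is
  killed by x_j because squares vanish, and still by the earlier vectors by anticommutation.\<close>

lemma exists_annihilated_multiple:
  assumes "d \<noteq> 0"
  shows "\<exists>b. b * d \<noteq> 0 \<and> (\<forall>j\<in>{1..k}. \<iota> (x j) * (b * d) = 0)"
proof (induction k)
  case 0
  show ?case using assms by (intro exI[of _ 1]) simp
next
  case (Suc k)
  then obtain b where b: "b * d \<noteq> 0" "\<And>j. j \<in> {1..k} \<Longrightarrow> \<iota> (x j) * (b * d) = 0" by blast
  show ?case
  proof (cases "\<iota> (x (Suc k)) * (b * d) = 0")
    case True
    with b show ?thesis by (intro exI[of _ b]) (auto simp: atLeastAtMostSuc_conv)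
  next
    case False
    have "\<iota> (x j) * (\<iota> (x (Suc k)) * (b * d)) = 0" if "j \<in> {1..k}" for j
    proof -
      have "\<iota> (x j) * (\<iota> (x (Suc k)) * (b * d)) = - (\<iota> (x (Suc k)) * (\<iota> (x j) * (b * d)))"
        by (simp add: mult.assoc[symmetric] iota_anticommute[of "x j" "x (Suc k)"])
      with b(2)[OF that] show ?thesis by simp
    qed
    moreover have "\<iota> (x (Suc k)) * (\<iota> (x (Suc k)) * (b * d)) = 0"
      by (simp add: mult.assoc[symmetric] iota_square)
    ultimately show ?thesis
      using False
      by (intro exI[of _ "\<iota> (x (Suc k)) * b"]) (auto simp: mult.assoc atLeastAtMostSuc_conv)
  qed
qed

text \<open>This yields uniqueness of the divergence, as the difference of two candidates is such a
  \<open>d\<close>.\<close>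

lemma top_coeff_nondegenerate:
  assumes "\<And>a. top_coeff (a * d) = 0"
  shows "d = 0"
proof (rule ccontr)
  assume "d \<noteq> 0"
  then obtain b where b: "b * d \<noteq> 0" "\<And>j. j \<in> {1..n} \<Longrightarrow> \<iota> (x j) * (b * d) = 0"
    using exists_annihilated_multiple by blast
  from annihilated_multiple[OF b(2), of n] obtain e where "b * d = top_form * e"
    by (auto simp: top_form_def)
  moreover obtain c where "top_form * e = scaleA c top_form" using top_form_mult by blast
  ultimately have bd: "b * d = scaleA c top_form" by simp
  with b(1) have "c \<noteq> 0" by auto
  moreover have "top_coeff (b * d) = c" by (simp add: bd top_coeff_scale top_coeff_top_form)
  ultimately show False using assms[of b] by simp
qed

section \<open>Divergences\<close>

lemma nakayama_divergence_eqI: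
  assumes leibniz: "\<And>a b. \<delta> (a * b) = \<delta> a * b + a * \<delta> b"
    and d: "\<And>c. top_coeff (\<delta> c) = top_coeff (c * d)"
  shows "nakayama_divergence scaleA \<iota> n x \<delta> = d"
  unfolding nakayama_divergence_def frobenius_form_def ext_integral_eq
proof (rule the_equality)
  have eq: "top_coeff (\<delta> a * b) + top_coeff (a * \<delta> b) = top_coeff (a * (b * d))" for a b
    using d[of "a * b"] by (simp add: leibniz top_coeff_add mult.assoc)
  then show "\<forall>a b. top_coeff (\<delta> a * b) + top_coeff (a * \<delta> b) = top_coeff (a * (b * d))"
    by blast
  fix d'
  assume d': "\<forall>a b. top_coeff (\<delta> a * b) + top_coeff (a * \<delta> b) = top_coeff (a * (b * d'))"
  \<comment> \<open>Specialising to \<open>b = 1\<close> leaves only the two candidate divergences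
    to compare.\<close>
  have "top_coeff (a * (d' - d)) = 0" for a
    using d'[rule_format, of a 1] eq[of a 1] by (simp add: right_diff_distrib top_coeff_diff)
  then have "d' - d = 0" by (rule top_coeff_nondegenerate)
  then show "d' = d" by simp
qed

text \<open>On odd elements the Nakayama automorphism is multiplication by this sign. The exponent
  \<open>n + 1\<close> has the parity of n - 1 without truncation at \<open>n = 0\<close>.\<close>

lemma top_coeff_odd_commute:
  assumes "a \<in> odd_part scaleA \<iota>"
  shows "top_coeff (a * c) = (-1) ^ (n + 1) * top_coeff (c * a)"
proof -
  define s :: 'k where "s = (-1) ^ (n + 1)"
  have words: "top_coeff (wedge us * wedge vs) = s * top_coeff (wedge vs * wedge us)"
    if "odd (length us)" for us vs
  proof (cases "length us + length vs = n")
    case True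
    \<comment> \<open>If p is odd and p + q = n, then pq, q and n - 1 have the same parity.\<close>
    then have "even (length us * length vs) \<longleftrightarrow> odd n"
      using that by (auto simp: even_add)
    then show ?thesis
      by (simp add: wedge_commute[of us vs] s_def minus_one_power_iff top_coeff_uminus)
  next
    case False
    then show ?thesis
      using top_coeff_wedge[of "us @ vs"] top_coeff_wedge[of "vs @ us"]
      by (simp add: wedge_append)
  qed
  have odd_word: "top_coeff (a * wedge vs) = s * top_coeff (wedge vs * a)" for vs
    using assms
  proof (induction a rule: odd_part_induct)
    case (step r us a)
    then show ?case
      by (simp add: words distrib_left distrib_right scale_mult_left scale_mult_right
          top_coeff_add top_coeff_scale mult.left_commute)
  qed simp
  have "top_coeff (a * c) = s * top_coeff (c * a)"
  proof (induction c rule: wedge_induct)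
    case (step r vs c)
    then show ?case
      by (simp add: odd_word distrib_left distrib_right scale_mult_left scale_mult_right
          top_coeff_add top_coeff_scale mult.left_commute)
  qed simp
  then show ?thesis by (simp add: s_def)
qed

lemma nakayama_divergence_ad:
  assumes "a \<in> odd_part scaleA \<iota>"
  shows "nakayama_divergence scaleA \<iota> n x (ad a) = (if even n then scaleA (- 2) a else 0)"
proof (rule nakayama_divergence_eqI)
  show "ad a (b * c) = ad a b * c + b * ad a c" for b c
    by (simp add: ad_def algebra_simps)
  \<comment> \<open>The integral of ac - ca is ((-1)^(n+1) - 1) times that of ca, and this factor is
    -2 or 0.\<close>
  show "top_coeff (ad a c) = top_coeff (c * (if even n then scaleA (- 2) a else 0))" for c
    by (simp add: ad_def top_coeff_diff top_coeff_odd_commute[OF assms] minus_one_power_iff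
        scale_mult_right top_coeff_scale top_coeff_uminus)
qed

section \<open>Vector fields with odd coefficients\<close>

lemma top_coeff_partial: "j \<in> {1..n} \<Longrightarrow> top_coeff (partial j c) = 0"
proof (induction c rule: wedge_induct)
  case (step r vs c)
  have "top_coeff (contract j vs) = 0"
  proof (cases "length vs \<le> n")
    case True
    \<comment> \<open>The index \<open>j\<close> forces n > 0, so \<open>length vs - 1\<close> lies
      below n even for the empty word.\<close>
    with step(2) show ?thesis
      by (intro top_coeff_low_degree[OF contract_wedge_power]) auto
  next
    case False
    then show ?thesis using partial_wedge[of j vs] wedge_long[of vs] by simp
  qed
  with step show ?case
    by (simp add: partial_add partial_scale partial_wedge top_coeff_add top_coeff_scale)
qed simp

lemma partial_odd_mult:
  assumes "a \<in> odd_part scaleA \<iota>"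
  shows "partial j (a * c) = partial j a * c - a * partial j c"
  using assms
proof (induction a rule: odd_part_induct)
  case (step r vs a)
  then show ?case
    by (simp add: distrib_left distrib_right partial_add scale_mult_left scale_mult_right
        partial_scale partial_wedge_mult partial_wedge A.scale_right_diff_distrib)
qed simp

text \<open>Odd length is positive, so \<open>length vs - 1\<close> is a genuine predecessor and
  hence even; even elements are central.\<close>

lemma partial_odd_commute:
  assumes "a \<in> odd_part scaleA \<iota>"
  shows "partial j a * c = c * partial j a"
  using assms
proof (induction a rule: odd_part_induct)
  case (step r vs a)
  have "b * c = c * b" if "b \<in> wedge_power scaleA \<iota> m" "even m" for b m
    using that
    by (induction b rule: wedge_power_induct)
      (simp_all add: distrib_left distrib_right scale_mult_left scale_mult_right even_commute)
  from this[OF contract_wedge_power[of j vs]] step show ?case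
    by (simp add: distrib_left distrib_right partial_add scale_mult_left scale_mult_right
        partial_scale partial_wedge)
qed simp

text \<open>The sign of the skew Leibniz rule for passing \<open>b\<close> cancels the sign from
  moving the odd element \<open>a\<close> past \<open>b\<close>, leaving an ordinary
  derivation.\<close>

lemma odd_partial_leibniz:
  assumes "a \<in> odd_part scaleA \<iota>"
  shows "a * partial j (b * c) = a * partial j b * c + b * (a * partial j c)"
proof (induction b rule: wedge_induct)
  case (step r vs b)
  have "a * ((-1) ^ length vs * (wedge vs * partial j c)) = wedge vs * (a * partial j c)"
  proof -
    have "a * ((-1) ^ length vs * (wedge vs * partial j c)) =
        (-1) ^ length vs * (a * wedge vs) * partial j c"
      by (simp add: minus_one_power_iff mult.assoc)
    then show ?thesis
      by (simp add: odd_wedge_commute[OF assms] A.neg_one_power_twice mult.assoc)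
  qed
  with step show ?case
    by (simp add: distrib_left distrib_right partial_add scale_mult_left scale_mult_right
        partial_scale partial_wedge_mult partial_wedge A.scale_right_distrib mult.assoc)
qed simp

lemma nakayama_divergence_vector_field:
  assumes "\<And>i. i \<in> {1..n} \<Longrightarrow> a i \<in> odd_part scaleA \<iota>"
  shows "nakayama_divergence scaleA \<iota> n x (\<lambda>b. \<Sum>i=1..n. a i * partial i b)
           = (\<Sum>i=1..n. partial i (a i))"
proof (rule nakayama_divergence_eqI)
  show "(\<Sum>i=1..n. a i * partial i (b * c)) =
      (\<Sum>i=1..n. a i * partial i b) * c + b * (\<Sum>i=1..n. a i * partial i c)" for b c
    unfolding sum_distrib_left sum_distrib_right sum.distrib[symmetric]
    using assms odd_partial_leibniz by (intro sum.cong) auto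
  show "top_coeff (\<Sum>i=1..n. a i * partial i c) = top_coeff (c * (\<Sum>i=1..n. partial i (a i)))" for c
    unfolding sum_distrib_left top_coeff_sum
  proof (rule sum.cong)
    fix i
    assume i: "i \<in> {1..n}"
    \<comment> \<open>The skew Leibniz rule for the product \<open>a i * c\<close>, solved for the
      wanted term, with the central factor moved to the right of \<open>c\<close>.\<close>
    have "a i * partial i c = c * partial i (a i) - partial i (a i * c)"
      using assms[OF i] by (simp add: partial_odd_mult partial_odd_commute)
    then show "top_coeff (a i * partial i c) = top_coeff (c * partial i (a i))"
      using i by (simp add: top_coeff_diff top_coeff_partial)
  qed simp
qed

end

theorem lemma48:
  fixes scaleV :: "'k::field \<Rightarrow> 'v::ab_group_add \<Rightarrow> 'v"
    and scaleA :: "'k \<Rightarrow> 'a::ring_1 \<Rightarrow> 'a"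
    and \<iota> :: "'v \<Rightarrow> 'a"
    and n :: nat
    and x :: "nat \<Rightarrow> 'v"
  assumes "CHAR('k) \<noteq> 2"
    and "exterior_algebra_basis scaleV scaleA \<iota> n x"
  shows "(\<forall>a\<in>odd_part scaleA \<iota>.
            nakayama_divergence scaleA \<iota> n x (ad a) = (if even n then scaleA (- 2) a else 0)) \<and>
         (\<forall>a :: nat \<Rightarrow> 'a. (\<forall>i\<in>{1..n}. a i \<in> odd_part scaleA \<iota>) \<longrightarrow>
            nakayama_divergence scaleA \<iota> n x (\<lambda>b. \<Sum>i=1..n. a i * ext_partial scaleA \<iota> n x i b)
              = (\<Sum>i=1..n. ext_partial scaleA \<iota> n x i (a i)))"
proof -
  interpret exterior_algebra_basis scaleV scaleA \<iota> n x by (fact assms(2))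
  show ?thesis
    using nakayama_divergence_ad nakayama_divergence_vector_field
    by (simp add: ext_partial_eq)
qed

end
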